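(* Let $\mathbb{X}$ be a finite dimensional real inner product space with induced norm $\|\cdot\|$, and let $\Phi:\mathbb{X}\to(-\infty,\infty]$ be a proper lower semicontinuous function that is coercive and bounded below. Let $m\ge 0$ be an integer, $a>0$, $b>0$, and let $\{x^k\}_{k\in\mathbb{N}}\subset\mathbb{X}$ be a sequence such that for each $k\in\mathbb{N}$: (H1) $\Phi(x^{k+1})+a\|x^{k+1}-x^k\|^2\le\max_{j=[k-m]_+,\ldots,k}\Phi(x^j)$; (H2) there exists $w^k\in\partial\Phi(x^k)$ such that $\|w^{k+1}\|\le b\|x^{k+1}-x^k\|$. Let $\varpi(x^0)$ be the set of cluster points of $\{x^k\}_{k\in\mathbb{N}}$. Suppose that $\Phi$ is a KL function associated to $\varphi(t)=ct^{1-\theta}$ with $\theta\in[0,1)$ and $c>0$, that $\liminf_{k\to\infty}\Phi(x^k)\ge\lim_{k\to\infty}\Phi(x^{\ell(k)})$, and that $\limsup_{j\to\infty}\Phi(x^{k_j})\le\Phi(\widehat{x})$ for each subsequence $\{x^{k_j}\}_{j\in\mathbb{N}}$ with $\lim_{j\to\infty}x^{k_j}=\widehat{x}$. Let $\Phi^*:=\lim_{k\to\infty}\Phi(x^k)$ (this limit exists). (i) When $\theta=0$, $\{x^k\}_{k\in\mathbb{N}}$ converges to a point $\widetilde{x}\in\varpi(x^0)$ in a finite number of steps. (ii) When $\theta\in(0,1)$, define $$K_1:=\big\{k\in\mathbb{N}\,|\,\Phi(x^{\ell(k+1)})-\Phi(x^{k+1})\ge\tfrac{a}{2}\|x^{k+1}-x^k\|^2\big\},$$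 $$K_2:=\big\{k\in\mathbb{N}\,|\,\tfrac{a}{2}\|x^{k+1}-x^k\|^2\le\Phi(x^{\ell(k+1)})-\Phi(x^{k+1})<\tfrac{a}{2}\|x^{k+1}-x^k\|^{\frac1\theta}\big\},$$ $$K_{31}:=\big\{k\in K_1\setminus K_2\,|\,\Phi^*-\Phi(x^{k+1})>\tfrac{a}{4}\|x^{k+1}-x^k\|^{\frac1\theta}\big\}.$$ If there exist $\widetilde{k}_0\in\mathbb{N}$, $\widetilde{\gamma}>0$ and $\widetilde{\tau}\in(0,1)$ such that for all $k\ge\widetilde{k}_0$ $$\sum_{j\in K_2\cup K_{31},\,j\ge k}\sqrt{\Phi(x^{\ell(j+1)})-\Phi(x^{j+1})}\le\begin{cases}\widetilde{\gamma}\,\widetilde{\tau}^k&\text{if }\theta\in(0,1/2],\\ \widetilde{\gamma}\,k^{\frac{1-\theta}{1-2\theta}}&\text{if }\theta\in(1/2,1),\end{cases}$$ then $\{x^k\}_{k\in\mathbb{N}}$ converges to a point $\widetilde{x}\in\varpi(x^0)$ and there exist $\gamma>0$ and $\varrho\in(0,1)$ such that for all sufficiently large $k$, $$\|x^k-\widetilde{x}\|\le\Delta_k\le\begin{cases}\gamma\varrho^k&\text{if }\theta\in(0,1/2],\\ \gamma k^{\frac{1-\theta}{1-2\theta}}&\text{if }\theta\in(1/2,1),\end{cases}\qquad\text{where }\Delta_k:=\sum_{j=k}^\infty\|x^{j+1}-x^j\|.$$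
   Context: $[t]_+:=\max(0,t)$. For each $k$, $\ell(k)$ denotes the largest index in $\arg\max_{j=[k-m]_+,\ldots,k}\Phi(x^j)$ (under (H1), $\{\Phi(x^{\ell(k)})\}$ is nonincreasing, so its limit exists). $\partial\Phi$ denotes the limiting (Mordukhovich) subdifferential; it is considered only at points of $\mathrm{dom}\,\Phi$. "$\Phi$ is a KL function associated to $\varphi(t)=ct^{1-\theta}$" means: for every $\overline{x}\in\mathrm{dom}\,\partial\Phi$ there exist $\eta\in(0,\infty]$ and a neighborhood $\mathcal{U}$ of $\overline{x}$ such that $\varphi'(\Phi(x)-\Phi(\overline{x}))\,\mathrm{dist}(0,\partial\Phi(x))\ge1$ for all $x\in\mathcal{U}$ with $\Phi(\overline{x})<\Phi(x)<\Phi(\overline{x})+\eta$. "Converges in a finite number of steps" means that $x^k=\widetilde{x}$ for all sufficiently large $k$. *)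

theory Defs
  imports "HOL-Analysis.Analysis"
begin

definition dom :: "('a \<Rightarrow> ereal) \<Rightarrow> 'a set" where
  "dom \<Phi> = {x. \<Phi> x < \<infinity>}"

definition proper :: "('a \<Rightarrow> ereal) \<Rightarrow> bool" where
  "proper \<Phi> \<longleftrightarrow> (\<forall>x. \<Phi> x \<noteq> -\<infinity>) \<and> dom \<Phi> \<noteq> {}"

definition lower_semicontinuous :: "('a::topological_space \<Rightarrow> ereal) \<Rightarrow> bool" where
  "lower_semicontinuous \<Phi> \<longleftrightarrow> (\<forall>x. \<Phi> x \<le> Liminf (at x) \<Phi>)"

definition coercive :: "('a::real_normed_vector \<Rightarrow> ereal) \<Rightarrow> bool" where
  "coercive \<Phi> \<longleftrightarrow> (\<Phi> \<longlongrightarrow> \<infinity>) at_infinity"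

definition bounded_below :: "('a \<Rightarrow> ereal) \<Rightarrow> bool" where
  "bounded_below \<Phi> \<longleftrightarrow> (\<exists>r::real. \<forall>x. ereal r \<le> \<Phi> x)"

(* Both subdifferentials are empty outside dom. On dom, \<Phi> x is finite for proper \<Phi>, so the
   ereal subtractions below are never of the form \<infinity> - \<infinity>. *)
definition frechet_subdifferential :: "('a::real_inner \<Rightarrow> ereal) \<Rightarrow> 'a \<Rightarrow> 'a set" where
  "frechet_subdifferential \<Phi> x =
     {v. x \<in> dom \<Phi> \<and>
         0 \<le> Liminf (at x) (\<lambda>y. (\<Phi> y - \<Phi> x - ereal (v \<bullet> (y - x))) / ereal (norm (y - x)))}"

definition limiting_subdifferential :: "('a::real_inner \<Rightarrow> ereal) \<Rightarrow> 'a \<Rightarrow> 'a set" where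
  "limiting_subdifferential \<Phi> x =
     {v. x \<in> dom \<Phi> \<and>
         (\<exists>y u. y \<longlonglongrightarrow> x \<and> (\<lambda>n. \<Phi> (y n)) \<longlonglongrightarrow> \<Phi> x \<and>
                (\<forall>n. u n \<in> frechet_subdifferential \<Phi> (y n)) \<and> u \<longlonglongrightarrow> v)}"

(* Unlike infdist, the distance to the empty set is infinite here. *)
definition edist_to :: "'a::metric_space \<Rightarrow> 'a set \<Rightarrow> ereal" where
  "edist_to x S = (INF y\<in>S. ereal (dist x y))"

definition KL_function :: "('a::real_inner \<Rightarrow> ereal) \<Rightarrow> (real \<Rightarrow> real) \<Rightarrow> bool" where
  "KL_function \<Phi> \<phi> \<longleftrightarrow>
     (\<forall>xbar. limiting_subdifferential \<Phi> xbar \<noteq> {} \<longrightarrow>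
       (\<exists>\<eta>::ereal. \<exists>U. 0 < \<eta> \<and> open U \<and> xbar \<in> U \<and>
         (\<forall>x\<in>U. \<Phi> xbar < \<Phi> x \<and> \<Phi> x < \<Phi> xbar + \<eta> \<longrightarrow>
            1 \<le> ereal (deriv \<phi> (real_of_ereal (\<Phi> x - \<Phi> xbar)))
                 * edist_to 0 (limiting_subdifferential \<Phi> x))))"

definition cluster_points :: "(nat \<Rightarrow> 'a::topological_space) \<Rightarrow> 'a set" where
  "cluster_points x = {z. \<exists>r::nat \<Rightarrow> nat. strict_mono r \<and> (\<lambda>j. x (r j)) \<longlonglongrightarrow> z}"

(* Truncated subtraction on nat gives [k - m]_+. *)
definition ell :: "('a \<Rightarrow> ereal) \<Rightarrow> (nat \<Rightarrow> 'a) \<Rightarrow> nat \<Rightarrow> nat \<Rightarrow> nat" where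
  "ell \<Phi> x m k = Max {i. is_arg_max (\<lambda>j. \<Phi> (x j)) (\<lambda>j. j \<in> {k - m..k}) i}"

definition gap :: "('a \<Rightarrow> ereal) \<Rightarrow> (nat \<Rightarrow> 'a) \<Rightarrow> nat \<Rightarrow> nat \<Rightarrow> ereal" where
  "gap \<Phi> x m k = \<Phi> (x (ell \<Phi> x m k)) - \<Phi> (x k)"

definition K1 :: "('a::real_normed_vector \<Rightarrow> ereal) \<Rightarrow> (nat \<Rightarrow> 'a) \<Rightarrow> nat \<Rightarrow> real \<Rightarrow> nat set" where
  "K1 \<Phi> x m a = {k. gap \<Phi> x m (k + 1) \<ge> ereal (a / 2 * norm (x (k + 1) - x k) ^ 2)}"

definition K2 ::
  "('a::real_normed_vector \<Rightarrow> ereal) \<Rightarrow> (nat \<Rightarrow> 'a) \<Rightarrow> nat \<Rightarrow> real \<Rightarrow> real \<Rightarrow> nat set" where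
  "K2 \<Phi> x m a \<theta> =
     {k. ereal (a / 2 * norm (x (k + 1) - x k) ^ 2) \<le> gap \<Phi> x m (k + 1) \<and>
         gap \<Phi> x m (k + 1) < ereal (a / 2 * norm (x (k + 1) - x k) powr (1 / \<theta>))}"

definition K31 ::
  "('a::real_normed_vector \<Rightarrow> ereal) \<Rightarrow> (nat \<Rightarrow> 'a) \<Rightarrow> nat \<Rightarrow> real \<Rightarrow> real \<Rightarrow> nat set" where
  "K31 \<Phi> x m a \<theta> =
     {k \<in> K1 \<Phi> x m a - K2 \<Phi> x m a \<theta>.
        lim (\<lambda>i. \<Phi> (x i)) - \<Phi> (x (k + 1)) > ereal (a / 4 * norm (x (k + 1) - x k) powr (1 / \<theta>))}"

(* At k = 0 and \<theta> > 1/2 this is 0 rather than infinity (0 powr r = 0); harmless, because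
   rates are only used for all k beyond some existentially quantified index. *)
definition rate :: "real \<Rightarrow> real \<Rightarrow> real \<Rightarrow> nat \<Rightarrow> real" where
  "rate \<theta> \<gamma> \<tau> k =
     (if \<theta> \<le> 1 / 2 then \<gamma> * \<tau> ^ k else \<gamma> * real k powr ((1 - \<theta>) / (1 - 2 * \<theta>)))"

definition Delta :: "(nat \<Rightarrow> 'a::real_normed_vector) \<Rightarrow> nat \<Rightarrow> real" where
  "Delta x k = (\<Sum>i. norm (x (k + i + 1) - x (k + i)))"

end

theory Submission
  imports Defs "HOL-Real_Asymp.Real_Asymp"
begin

text \<open>
  Write \<open>v k\<close> for the maximum of \<open>\<Phi>\<close> over the window ending at \<open>x k\<close>, minus the limit \<open>L\<close> of \<open>\<Phi> (x k)\<close>.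
  It decreases to \<open>0\<close>. At an index where the window maximum is attained, the KL inequality bounds
  \<open>v k powr \<theta>\<close> by the length of the step leading there, and (H1) turns this into the recursion
  \<open>v (k + n) + \<kappa> * v (k + n) powr (2 * \<theta>) \<le> v k\<close> with \<open>n = m + 1\<close>. This gives the decay of \<open>v\<close>:
  geometric for \<open>\<theta> \<le> 1 / 2\<close>, and of order \<open>k powr (1 / (1 - 2 * \<theta>))\<close> otherwise.

  A step with index outside \<open>K1\<close> has squared length at most a multiple of \<open>v k - v (k + 1)\<close>, hence, by AM-GM
  and concavity of \<open>t powr (1 - \<theta>)\<close>, length at most a multiple of
  \<open>v k powr \<theta> + (v k powr (1 - \<theta>) - v (k + 1) powr (1 - \<theta>))\<close>. A step with index in \<open>K1\<close> but neither in \<open>K2\<close>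
  nor in \<open>K31\<close> has length at most a multiple of \<open>v k powr \<theta>\<close>. The remaining steps are controlled by the hypothesis
  on \<open>K2\<close> and \<open>K31\<close>. Summing over the tail gives the rate of \<open>Delta\<close>.
\<close>

subsection \<open>Decay rates from recursive inequalities\<close>

text \<open>The hypothesis \<open>step\<close> is an induction step in contrapositive form: an
  excess of \<open>u\<close> over \<open>G * w\<close> at \<open>k + n\<close> would already be
  present at \<open>k\<close>. So a bound on the first window of length \<open>n\<close> propagates,
  and \<open>G\<close> only has to be large enough there and at least \<open>G0\<close>.\<close>

lemma comparison:
  fixes u w :: "nat \<Rightarrow> real"
  assumes n: "n > 0" and w: "\<And>k. k \<ge> K \<Longrightarrow> w k > 0"
    and step: "\<And>G k. G \<ge> G0 \<Longrightarrow> k \<ge> K \<Longrightarrow> G * w (k + n) < u (k + n) \<Longrightarrow> G * w k < u k"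
  shows "\<exists>G>0. \<forall>k\<ge>K. u k \<le> G * w k"
proof -
  define G where "G = max (max 1 G0) (Max ((\<lambda>k. u k / w k) ` {K..<K + n}))"
  have G: "G \<ge> 1" "G \<ge> G0"
    by (auto simp: G_def)
  have base: "u k \<le> G * w k" if "K \<le> k" "k < K + n" for k
  proof -
    have "u k / w k \<le> G"
      unfolding G_def using that by (intro max.coboundedI2 Max_ge) auto
    then show ?thesis
      using w[OF that(1)] by (simp add: divide_simps)
  qed
  have "u k \<le> G * w k" if "k \<ge> K" for k
    using that
  proof (induction k rule: less_induct)
    case (less k)
    show ?case
    proof (cases "k < K + n")
      case True
      then show ?thesis using base less.prems by blast
    next
      case False
      then have k: "k - n < k" "k - n \<ge> K" "k - n + n = k"
        using n by auto
      then have "\<not> G * w (k - n) < u (k - n)"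
        using less.IH by force
      then show ?thesis
        using step[OF G(2) k(2)] k(3) by force
    qed
  qed
  then show ?thesis
    using G(1) by (intro exI[of _ G]) auto
qed

text \<open>Comparison with the geometric sequence whose ratio is the \<open>n\<close>-th root of
  \<open>q\<close>, so that \<open>n\<close> steps cost exactly the factor \<open>q\<close>.\<close>

lemma linear_recursion_rate:
  fixes u :: "nat \<Rightarrow> real"
  assumes n: "n > 0" and q: "0 < q" "q < 1"
    and rec: "\<forall>\<^sub>F k in sequentially. u (k + n) \<le> q * u k"
  shows "\<exists>G \<sigma>. 0 < G \<and> 0 < \<sigma> \<and> \<sigma> < 1 \<and> (\<forall>\<^sub>F k in sequentially. u k \<le> G * \<sigma> ^ k)"
proof -
  define \<sigma> where "\<sigma> = q powr (1 / n)"
  have \<sigma>: "0 < \<sigma>" "\<sigma> < 1" "\<sigma> ^ n = q"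
    using n q powr_mono2'[of "0" q 1]
    by (auto simp: \<sigma>_def powr_power powr01_less_one)
  obtain K where K: "\<And>k. k \<ge> K \<Longrightarrow> u (k + n) \<le> q * u k"
    using rec by (auto simp: eventually_sequentially)
  have "\<exists>G>0. \<forall>k\<ge>K. u k \<le> G * \<sigma> ^ k"
  proof (rule comparison[OF n, where ?G0.0 = 0])
    fix G :: real and k
    assume "k \<ge> K" "G * \<sigma> ^ (k + n) < u (k + n)"
    then have "q * (G * \<sigma> ^ k) < q * u k"
      using K[of k] by (simp add: power_add \<sigma>(3) mult_ac)
    then show "G * \<sigma> ^ k < u k"
      using q(1) by simp
  qed (use \<sigma> in auto)
  then show ?thesis
    using \<sigma> unfolding eventually_sequentially by blast
qed

text \<open>A discrete form of u' = - \<kappa> u^(1+p), whose solutions decay like t^(-1/p). Over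
  \<open>n\<close> steps the comparison sequence G k^(-1/p) drops by an amount linear in
  \<open>G\<close>, while the damping term is of order G^(1+p) and dominates for large
  \<open>G\<close>.\<close>

lemma sublinear_recursion_rate:
  fixes u :: "nat \<Rightarrow> real"
  assumes n: "n > 0" and p: "0 < p" and \<kappa>: "0 < \<kappa>"
    and rec: "\<forall>\<^sub>F k in sequentially. u (k + n) + \<kappa> * u (k + n) powr (1 + p) \<le> u k"
  shows "\<exists>G>0. \<forall>\<^sub>F k in sequentially. u k \<le> G * real k powr (- (1 / p))"
proof -
  define q where "q = 1 / p"
  \<comment> \<open>The drop of k^(-q) over \<open>n\<close> steps is asymptotically q n k^(-q-1),
    and the added 1 absorbs the error. \<open>G0\<close> is the threshold beyond which
    \<open>\<kappa> * G powr p\<close> is at least \<open>E\<close>.\<close>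
  define E where "E = q * n + 1"
  define G0 where "G0 = max 1 ((E / \<kappa>) powr q)"
  have q: "q > 0" and E: "E > 0"
    using p by (auto simp: q_def E_def intro!: add_nonneg_pos)
  have qp: "q * p = 1"
    using p by (simp add: q_def)
  have G0: "\<kappa> * G powr p \<ge> E" "G \<ge> 1" if "G \<ge> G0" for G
  proof -
    have "E / \<kappa> = ((E / \<kappa>) powr q) powr p"
      using E \<kappa> qp by (simp add: powr_powr)
    also have "\<dots> \<le> G powr p"
      using that p by (intro powr_mono2) (auto simp: G0_def)
    finally show "\<kappa> * G powr p \<ge> E"
      using \<kappa> by (simp add: divide_simps mult_ac)
    show "G \<ge> 1" using that by (simp add: G0_def)
  qed
  have "\<forall>\<^sub>F k in sequentially. real k powr (- q) \<le> real (k + n) powr (- q) + E * real (k + n) powr (- q - 1)"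
    unfolding E_def using q by real_asymp
  then have "\<forall>\<^sub>F k in sequentially. real k powr (- q) \<le> real (k + n) powr (- q) + E * real (k + n) powr (- q - 1)
      \<and> u (k + n) + \<kappa> * u (k + n) powr (1 + p) \<le> u k \<and> k > 0"
    using rec eventually_gt_at_top[of 0] by eventually_elim auto
  then obtain K where
      K: "\<And>k. k \<ge> K \<Longrightarrow> real k powr (- q) \<le> real (k + n) powr (- q) + E * real (k + n) powr (- q - 1)"
         "\<And>k. k \<ge> K \<Longrightarrow> u (k + n) + \<kappa> * u (k + n) powr (1 + p) \<le> u k"
         "\<And>k. k \<ge> K \<Longrightarrow> k > 0"
    by (auto simp: eventually_sequentially)
  have "\<exists>G>0. \<forall>k\<ge>K. u k \<le> G * real k powr (- q)"
  proof (rule comparison[OF n, where ?G0.0 = G0])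
    fix G :: real and k
    assume G: "G \<ge> G0" and k: "k \<ge> K" and *: "G * real (k + n) powr (- q) < u (k + n)"
    define t where "t = real (k + n)"
    have t: "t > 0" using K(3)[OF k] by (simp add: t_def)
    have "E * t powr (- q - 1) \<le> \<kappa> * G powr p * t powr (- q - 1)"
      using G0[OF G] by (intro mult_right_mono) auto
    then have "G * (E * t powr (- q - 1)) \<le> G * (\<kappa> * G powr p * t powr (- q - 1))"
      using G0[OF G] by (intro mult_left_mono) auto
    also have "\<dots> = \<kappa> * (G * t powr (- q)) powr (1 + p)"
    proof -
      have "- q * (1 + p) = - q - 1"
        using qp by (simp add: algebra_simps)
      moreover have "G powr (1 + p) = G * G powr p"
        using G0[OF G] by (simp add: powr_add)
      ultimately show ?thesis
        by (simp only: powr_mult powr_powr mult_ac)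
    qed
    also have "\<dots> \<le> \<kappa> * u (k + n) powr (1 + p)"
      using * \<kappa> p G0[OF G] by (intro mult_left_mono powr_mono2) (auto simp: t_def)
    finally have "G * (E * t powr (- q - 1)) \<le> \<kappa> * u (k + n) powr (1 + p)" .
    moreover have "G * real k powr (- q) \<le> G * (t powr (- q) + E * t powr (- q - 1))"
      using K(1)[OF k] G0[OF G] unfolding t_def by (intro mult_left_mono) auto
    ultimately show "G * real k powr (- q) < u k"
      using K(2)[OF k] * by (simp add: t_def algebra_simps)
  qed (use K in auto)
  then show ?thesis
    unfolding eventually_sequentially q_def by blast
qed

lemma rate_mono:
  assumes "0 \<le> \<gamma>" "\<gamma> \<le> \<gamma>'" "0 \<le> \<tau>" "\<tau> \<le> \<tau>'"
  shows "rate \<theta> \<gamma> \<tau> k \<le> rate \<theta> \<gamma>' \<tau>' k"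
  using assms by (auto simp: rate_def intro!: mult_mono power_mono)

lemma rate_add: "rate \<theta> \<gamma> \<tau> k + rate \<theta> \<gamma>' \<tau> k = rate \<theta> (\<gamma> + \<gamma>') \<tau> k"
  by (simp add: rate_def algebra_simps)

lemma rate_scale: "c * rate \<theta> \<gamma> \<tau> k = rate \<theta> (c * \<gamma>) \<tau> k"
  by (simp add: rate_def)

lemma rate_nonneg: "0 \<le> \<gamma> \<Longrightarrow> 0 \<le> \<tau> \<Longrightarrow> 0 \<le> rate \<theta> \<gamma> \<tau> k"
  by (simp add: rate_def)

text \<open>The bound on \<^term>\<open>v k powr \<theta>\<close> is by a difference of consecutive rates, so that it telescopes
  when it is summed.\<close>

lemma recursion_rate:
  fixes v :: "nat \<Rightarrow> real"
  assumes \<theta>: "0 < \<theta>" "\<theta> < 1" and n: "n > 0" and \<kappa>: "0 < \<kappa>"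
    and nonneg: "\<And>k. 0 \<le> v k" and lim: "v \<longlonglongrightarrow> 0"
    and rec: "\<forall>\<^sub>F k in sequentially. v (k + n) + \<kappa> * v (k + n) powr (2 * \<theta>) \<le> v k"
  shows "\<exists>\<gamma> \<rho>. 0 < \<gamma> \<and> 0 < \<rho> \<and> \<rho> < 1 \<and> (\<forall>\<^sub>F k in sequentially.
           v k powr \<theta> \<le> rate \<theta> \<gamma> \<rho> k - rate \<theta> \<gamma> \<rho> (Suc k) \<and> v k powr (1 - \<theta>) \<le> rate \<theta> \<gamma> \<rho> k)"
proof (cases "\<theta> \<le> 1 / 2")
  case True
  have lim_n: "(\<lambda>k. v (k + n)) \<longlonglongrightarrow> 0"
    using lim by (rule LIMSEQ_ignore_initial_segment)
  \<comment> \<open>Since 2 \<theta> \<le> 1, a value below 1 is at most its power with exponent 2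
    \<theta>; the recursion becomes linear with factor 1 / (1 + \<kappa>).\<close>
  have "\<forall>\<^sub>F k in sequentially. v (k + n) < 1"
    using order_tendstoD(2)[OF lim_n] by simp
  then have "\<forall>\<^sub>F k in sequentially. v (k + n) \<le> 1 / (1 + \<kappa>) * v k"
    using rec
  proof eventually_elim
    case (elim k)
    have "v (k + n) powr 1 \<le> v (k + n) powr (2 * \<theta>)"
      using True elim nonneg by (intro powr_mono') auto
    then have "v (k + n) \<le> v (k + n) powr (2 * \<theta>)"
      using nonneg by simp
    then have "\<kappa> * v (k + n) \<le> \<kappa> * v (k + n) powr (2 * \<theta>)"
      using \<kappa> by simp
    then have "(1 + \<kappa>) * v (k + n) \<le> v k"
      using elim(2) by (simp add: distrib_right)
    then show ?case
      using \<kappa> by (simp add: field_simps)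
  qed
  then obtain G \<sigma> where G: "0 < G" "0 < \<sigma>" "\<sigma> < 1"
      and v: "\<forall>\<^sub>F k in sequentially. v k \<le> G * \<sigma> ^ k"
    using linear_recursion_rate[of n "1 / (1 + \<kappa>)" v] n \<kappa> by (auto simp: add_pos_pos)
  define \<rho> where "\<rho> = \<sigma> powr \<theta>"
  have \<rho>: "0 < \<rho>" "\<rho> < 1"
    using G \<theta> by (auto simp: \<rho>_def powr01_less_one)
  \<comment> \<open>Dividing by 1 - \<rho> turns \<rho>^k into a difference of consecutive geometric
    terms; the second entry serves the exponent 1 - \<theta>.\<close>
  define \<gamma> where "\<gamma> = max (G powr \<theta> / (1 - \<rho>)) (G powr (1 - \<theta>))"
  have "\<gamma> > 0" using G \<rho> by (simp add: \<gamma>_def less_max_iff_disj)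
  have "\<forall>\<^sub>F k in sequentially.
           v k powr \<theta> \<le> rate \<theta> \<gamma> \<rho> k - rate \<theta> \<gamma> \<rho> (Suc k) \<and> v k powr (1 - \<theta>) \<le> rate \<theta> \<gamma> \<rho> k"
    using v
  proof eventually_elim
    case (elim k)
    have pw: "(\<sigma> ^ k) powr \<theta> = \<rho> ^ k"
      using G by (simp add: \<rho>_def powr_powr powr_power mult_ac flip: powr_realpow)
    have "v k powr \<theta> \<le> (G * \<sigma> ^ k) powr \<theta>"
      using elim nonneg \<theta> by (intro powr_mono2) auto
    also have "\<dots> = (G powr \<theta> / (1 - \<rho>)) * ((1 - \<rho>) * \<rho> ^ k)"
      using G \<rho> pw by (simp add: powr_mult)
    also have "\<dots> \<le> \<gamma> * ((1 - \<rho>) * \<rho> ^ k)"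
      using \<rho> by (intro mult_right_mono) (auto simp: \<gamma>_def)
    also have "\<dots> = rate \<theta> \<gamma> \<rho> k - rate \<theta> \<gamma> \<rho> (Suc k)"
      using True by (simp add: rate_def algebra_simps)
    finally have 1: "v k powr \<theta> \<le> rate \<theta> \<gamma> \<rho> k - rate \<theta> \<gamma> \<rho> (Suc k)" .
    have "v k powr (1 - \<theta>) \<le> (G * \<sigma> ^ k) powr (1 - \<theta>)"
      using elim nonneg \<theta> by (intro powr_mono2) auto
    also have "\<dots> = G powr (1 - \<theta>) * (\<sigma> ^ k) powr (1 - \<theta>)"
      using G by (simp add: powr_mult)
    \<comment> \<open>Here \<sigma>^k \<le> 1 and \<theta> \<le> 1 - \<theta>, so lowering the
      exponent enlarges the power.\<close>
    also have "\<dots> \<le> G powr (1 - \<theta>) * (\<sigma> ^ k) powr \<theta>"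
      using G True by (intro mult_left_mono powr_mono') (auto simp: power_le_one)
    also have "\<dots> \<le> \<gamma> * \<rho> ^ k"
      unfolding pw using \<rho> by (intro mult_right_mono) (auto simp: \<gamma>_def)
    also have "\<dots> = rate \<theta> \<gamma> \<rho> k"
      using True by (simp add: rate_def)
    finally show ?case using 1 by simp
  qed
  then show ?thesis using \<open>\<gamma> > 0\<close> \<rho> by blast
next
  case False
  \<comment> \<open>This makes 1 + p equal to 2 \<theta>, the exponent in the recursion; - e is the
    exponent occurring in \<open>rate\<close>.\<close>
  define p where "p = 2 * \<theta> - 1"
  define e where "e = (1 - \<theta>) / p"
  have p: "p > 0" and e: "e > 0"
    using False \<theta> by (auto simp: p_def e_def)
  have expo: "(1 - \<theta>) / (1 - 2 * \<theta>) = - e" "- (\<theta> / p) = - e - 1" "- (1 / p) * (1 - \<theta>) = - e"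
    using p by (auto simp: e_def p_def field_simps)
  obtain G where G: "G > 0" and v: "\<forall>\<^sub>F k in sequentially. v k \<le> G * real k powr (- (1 / p))"
    using sublinear_recursion_rate[OF n p \<kappa>, of v] rec by (auto simp: p_def)
  define \<gamma> where "\<gamma> = max (2 / e * G powr \<theta>) (G powr (1 - \<theta>))"
  have "\<gamma> > 0" using G by (simp add: \<gamma>_def less_max_iff_disj)
  \<comment> \<open>The difference on the right is asymptotically e k^(-e-1), so the factor 2 leaves
    room for the inequality to hold eventually.\<close>
  have "\<forall>\<^sub>F k in sequentially. real k powr (- e - 1) \<le> 2 / e * (real k powr (- e) - real (Suc k) powr (- e))"
    using e by real_asymp
  \<comment> \<open>For \<theta> > 1/2 the rate is a power of \<open>k\<close>; 1/2 is an arbitrary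
    base in (0,1).\<close>
  then have "\<forall>\<^sub>F k in sequentially.
           v k powr \<theta> \<le> rate \<theta> \<gamma> (1/2) k - rate \<theta> \<gamma> (1/2) (Suc k) \<and> v k powr (1 - \<theta>) \<le> rate \<theta> \<gamma> (1/2) k"
    using v eventually_gt_at_top[of 0]
  proof eventually_elim
    case (elim k)
    have "v k powr \<theta> \<le> (G * real k powr (- (1 / p))) powr \<theta>"
      using elim nonneg \<theta> by (intro powr_mono2) auto
    also have "\<dots> = G powr \<theta> * real k powr (- e - 1)"
      using G expo(2) by (simp add: powr_mult powr_powr)
    also have "\<dots> \<le> G powr \<theta> * (2 / e * (real k powr (- e) - real (Suc k) powr (- e)))"
      using elim(1) by (intro mult_left_mono) auto
    also have "\<dots> = (2 / e * G powr \<theta>) * (real k powr (- e) - real (Suc k) powr (- e))"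
      by simp
    also have "\<dots> \<le> \<gamma> * (real k powr (- e) - real (Suc k) powr (- e))"
      using e elim by (intro mult_right_mono) (auto simp: \<gamma>_def intro!: powr_mono2')
    also have "\<dots> = rate \<theta> \<gamma> (1/2) k - rate \<theta> \<gamma> (1/2) (Suc k)"
      unfolding rate_def expo(1) using False by (simp add: algebra_simps)
    finally have 1: "v k powr \<theta> \<le> rate \<theta> \<gamma> (1/2) k - rate \<theta> \<gamma> (1/2) (Suc k)" .
    have "v k powr (1 - \<theta>) \<le> (G * real k powr (- (1 / p))) powr (1 - \<theta>)"
      using elim nonneg \<theta> by (intro powr_mono2) auto
    also have "\<dots> = G powr (1 - \<theta>) * real k powr (- e)"
      by (simp only: powr_mult powr_powr expo(3))
    also have "\<dots> \<le> \<gamma> * real k powr (- e)"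
      by (intro mult_right_mono) (auto simp: \<gamma>_def)
    also have "\<dots> = rate \<theta> \<gamma> (1/2) k"
      unfolding rate_def expo(1) using False by simp
    finally show ?case using 1 by simp
  qed
  then show ?thesis
    using \<open>\<gamma> > 0\<close> by (intro exI[of _ \<gamma>] exI[of _ "1/2"]) simp
qed

text \<open>Weighted AM-GM yields the tangent inequality of the concave function t^(1-\<theta>) at
  \<open>v\<close>, that is, (1-\<theta>)(v-u) \<le> v^\<theta> (v^(1-\<theta>) - u^(1-\<theta>)).
  Ordinary AM-GM then splits the root of the product, leaving a difference that telescopes along a
  sequence.\<close>

lemma sqrt_diff_le:
  fixes u v \<theta> :: real
  assumes "0 \<le> u" "u \<le> v" "0 < \<theta>" "\<theta> < 1"
  shows "sqrt (v - u) \<le> v powr \<theta> + (v powr (1 - \<theta>) - u powr (1 - \<theta>)) / (1 - \<theta>)"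
proof -
  define g where "g = (v powr (1 - \<theta>) - u powr (1 - \<theta>)) / (1 - \<theta>)"
  have g: "g \<ge> 0"
    unfolding g_def using assms by (intro divide_nonneg_pos) (auto intro!: powr_mono2)
  have *: "u powr (1 - \<theta>) * v powr \<theta> \<le> (1 - \<theta>) * u + \<theta> * v"
  proof (cases "u = 0")
    case True
    then show ?thesis using assms by simp
  next
    case False
    then show ?thesis
      using assms Youngs_inequality_0[of "1 - \<theta>" \<theta> u v] by simp
  qed
  have "v powr \<theta> * v powr (1 - \<theta>) = v"
    using assms by (simp flip: powr_add)
  then have "(1 - \<theta>) * (v - u) \<le> v powr \<theta> * (v powr (1 - \<theta>) - u powr (1 - \<theta>))"
    using * by (simp add: algebra_simps)
  then have "v - u \<le> v powr \<theta> * g"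
    using assms by (simp add: g_def field_simps)
  then have "sqrt (v - u) \<le> sqrt (v powr \<theta> * g)"
    by simp
  also have "\<dots> \<le> (v powr \<theta> + g) / 2"
    using g by (intro arith_geo_mean_sqrt) auto
  also have "\<dots> \<le> v powr \<theta> + g"
    using g by simp
  finally show ?thesis by (simp add: g_def)
qed

subsection \<open>Nonmonotone descent of real sequences\<close>

definition window_max :: "(nat \<Rightarrow> real) \<Rightarrow> nat \<Rightarrow> nat \<Rightarrow> real" where
  "window_max f m k = Max (f ` {k - m..k})"

lemma window_max_ge: "k - m \<le> j \<Longrightarrow> j \<le> k \<Longrightarrow> f j \<le> window_max f m k"
  by (auto simp: window_max_def intro!: Max_ge)

lemma window_max_attained: "\<exists>j\<in>{k - m..k}. window_max f m k = f j"
proof -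
  have "Max (f ` {k - m..k}) \<in> f ` {k - m..k}"
    by (intro Max_in) auto
  then show ?thesis by (force simp: window_max_def)
qed

text \<open>When the window advances by one, the only new value is \<open>f (Suc k)\<close>, and the
  descent inequality keeps it below the old maximum.\<close>

lemma window_max_decseq:
  fixes a :: real
  assumes "0 \<le> a" and descent: "\<And>k. f (Suc k) + a * (d k)\<^sup>2 \<le> window_max f m k"
  shows "decseq (window_max f m)"
proof (rule decseq_SucI)
  fix k
  obtain j where j: "j \<in> {Suc k - m..Suc k}" "window_max f m (Suc k) = f j"
    using window_max_attained by blast
  show "window_max f m (Suc k) \<le> window_max f m k"
  proof (cases "j = Suc k")
    case True
    have "0 \<le> a * (d k)\<^sup>2" using \<open>0 \<le> a\<close> by simp
    then show ?thesis using True descent[of k] j(2) by simp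
  next
    case False
    then show ?thesis using j window_max_ge[of k m j f] by auto
  qed
qed

text \<open>The scalar shadow of the iteration: \<open>f\<close> stands for the values of \<Phi>
  along the iterates, \<open>d\<close> for the step lengths, and \<open>descent\<close> for
  (H1).\<close>

locale nonmonotone_descent =
  fixes f d :: "nat \<Rightarrow> real" and m :: nat and a L :: real
  assumes a_pos: "0 < a"
    and d_nonneg: "\<And>k. 0 \<le> d k"
    and descent: "\<And>k. f (Suc k) + a * (d k)\<^sup>2 \<le> window_max f m k"
    and f_lim: "f \<longlonglongrightarrow> L"
    and max_lim: "window_max f m \<longlonglongrightarrow> L"
begin

definition v :: "nat \<Rightarrow> real" where
  "v k = window_max f m k - L"

lemma decseq_max: "decseq (window_max f m)"
  using a_pos descent by (intro window_max_decseq[where a = a and d = d]) auto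

lemma max_antimono: "j \<le> k \<Longrightarrow> window_max f m k \<le> window_max f m j"
  using decseq_max by (rule decseqD)

lemma max_ge_L: "L \<le> window_max f m k"
  using decseq_ge[OF decseq_max max_lim] .

lemma v_nonneg: "0 \<le> v k"
  using max_ge_L by (simp add: v_def)

lemma v_Suc_le: "v (Suc k) \<le> v k"
  using max_antimono[of k "Suc k"] by (simp add: v_def)

lemma v_lim: "v \<longlonglongrightarrow> 0"
  using max_lim unfolding v_def by (simp add: LIM_zero)

text \<open>Descent bounds a d^2 by the difference of two sequences with the common limit
  \<open>L\<close>.\<close>

lemma d_lim: "d \<longlonglongrightarrow> 0"
proof -
  have "(\<lambda>k. (window_max f m k - f (Suc k)) / a) \<longlonglongrightarrow> (L - L) / a"
    using max_lim f_lim a_pos by (intro tendsto_intros LIMSEQ_Suc) auto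
  then have "(\<lambda>k. (window_max f m k - f (Suc k)) / a) \<longlonglongrightarrow> 0"
    by simp
  then have "(\<lambda>k. (d k)\<^sup>2) \<longlonglongrightarrow> 0"
  proof (rule tendsto_sandwich[rotated 3, OF _])
    show "\<forall>\<^sub>F k in sequentially. (d k)\<^sup>2 \<le> (window_max f m k - f (Suc k)) / a"
      using descent a_pos by (intro always_eventually allI) (simp add: field_simps)
  qed auto
  then have "(\<lambda>k. sqrt ((d k)\<^sup>2)) \<longlonglongrightarrow> sqrt 0"
    by (intro tendsto_intros)
  then show ?thesis using d_nonneg by simp
qed

end

text \<open>The pairing of \<open>f (Suc k)\<close> with \<open>d k\<close> reflects (H2), which
  bounds the subgradient at the new point by the step leading to it.\<close>

locale nonmonotone_descent_KL = nonmonotone_descent +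
  fixes C \<theta> :: real
  assumes C_pos: "0 < C"
    and KL: "\<forall>\<^sub>F k in sequentially. L < f (Suc k) \<longrightarrow> (f (Suc k) - L) powr \<theta> \<le> C * d k"
begin

text \<open>Once the values are at most \<open>L\<close>, every window contains an index at which \<open>f\<close> equals \<open>L\<close>; such a
  step has length zero, so \<open>f\<close> was already \<open>L\<close> one index earlier, and one can walk back.\<close>

lemma finite_termination:
  assumes \<theta>: "\<theta> = 0" and stay: "\<And>k. d k = 0 \<Longrightarrow> f (Suc k) = f k"
  shows "\<forall>\<^sub>F k in sequentially. d k = 0"
proof -
  have "\<forall>\<^sub>F k in sequentially. d k < 1 / C"
    using order_tendstoD(2)[OF d_lim] C_pos by simp
  \<comment> \<open>Above \<open>L\<close> the zeroth power equals 1, so KL would force a step of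
    length at least 1 / C.\<close>
  then have "\<forall>\<^sub>F k in sequentially. f (Suc k) \<le> L"
    using KL
  proof eventually_elim
    case (elim k)
    show ?case
    proof (rule ccontr)
      assume "\<not> f (Suc k) \<le> L"
      then have "1 \<le> C * d k"
        using elim(2) \<theta> by simp
      then show False
        using elim(1) C_pos by (simp add: field_simps)
    qed
  qed
  then obtain K where K: "\<And>k. k \<ge> K \<Longrightarrow> f (Suc k) \<le> L"
    by (auto simp: eventually_sequentially)
  \<comment> \<open>Such a window starts no earlier than \<open>Suc K\<close>, so all its values are
    at most \<open>L\<close>, while its maximum is never below \<open>L\<close>.\<close>
  have max_eq: "window_max f m k = L" if k: "k \<ge> Suc K + m" for k
  proof (rule antisym)
    obtain j where j: "j \<in> {k - m..k}" "window_max f m k = f j"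
      using window_max_attained by blast
    then obtain i where "j = Suc i" "i \<ge> K"
      using k by (cases j) auto
    then show "window_max f m k \<le> L"
      using K j(2) by simp
  qed (rule max_ge_L)
  have zero: "d k = 0" if "k \<ge> Suc K + m" "f (Suc k) = L" for k
  proof -
    have "a * (d k)\<^sup>2 \<le> 0"
      using descent[of k] that max_eq by simp
    then show ?thesis
      using a_pos by (simp add: mult_le_0_iff)
  qed
  have go_back: "f (Suc k) = L" if "k \<ge> Suc K + m" "f (Suc k + i) = L" for k i
    using that(2)
  proof (induction i)
    case (Suc i)
    then have "d (Suc k + i) = 0"
      using zero[of "Suc k + i"] that(1) by simp
    then show ?case
      using stay[of "Suc k + i"] Suc by simp
  qed simp
  have "d k = 0" if k: "k \<ge> Suc K + m" for k
  proof -
    \<comment> \<open>The window ending at \<open>Suc k + m\<close> begins at \<open>Suc k\<close>,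
      so the value \<open>L\<close> occurs at or after \<open>Suc k\<close> and can be traced back
      to it.\<close>
    obtain j where j: "j \<in> {Suc k + m - m..Suc k + m}" "window_max f m (Suc k + m) = f j"
      using window_max_attained by blast
    then have "f (Suc k + (j - Suc k)) = L"
      using max_eq[of "Suc k + m"] k by simp
    then show ?thesis
      using go_back[OF k] zero[OF k] by blast
  qed
  then show ?thesis
    by (auto simp: eventually_sequentially)
qed

text \<open>The shift by \<open>Suc m\<close> lets the window start just after \<open>k\<close>, so
  its maximum is attained at some \<open>Suc i\<close> with i \<ge> k. KL there bounds the power of
  \<open>v\<close> by \<open>d i\<close>, and descent at \<open>i\<close> together with monotonicity
  of the window maximum converts this into a decrease.\<close>

lemma v_recursion:
  "\<forall>\<^sub>F k in sequentially. v (k + Suc m) + a / C\<^sup>2 * v (k + Suc m) powr (2 * \<theta>) \<le> v k"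
proof -
  obtain K where K: "\<And>k. k \<ge> K \<Longrightarrow> L < f (Suc k) \<longrightarrow> (f (Suc k) - L) powr \<theta> \<le> C * d k"
    using KL by (auto simp: eventually_sequentially)
  have "v (k + Suc m) + a / C\<^sup>2 * v (k + Suc m) powr (2 * \<theta>) \<le> v k" if k: "k \<ge> K" for k
  proof (cases "v (k + Suc m) = 0")
    \<comment> \<open>The value of \<open>0 powr r\<close> is 0 even for r = 0, so only
      nonnegativity of \<open>v k\<close> is left to show.\<close>
    case True
    then show ?thesis using v_nonneg by simp
  next
    case False
    then have pos: "v (k + Suc m) > 0"
      using v_nonneg[of "k + Suc m"] by simp
    obtain j where j: "j \<in> {k + Suc m - m..k + Suc m}" "window_max f m (k + Suc m) = f j"
      using window_max_attained by blast
    then obtain i where i: "j = Suc i" "i \<ge> k"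
      by (cases j) auto
    have v_eq: "v (k + Suc m) = f (Suc i) - L"
      using j i by (simp add: v_def)
    have "v (k + Suc m) powr (2 * \<theta>) = (v (k + Suc m) powr \<theta>)\<^sup>2"
      using pos by (simp add: powr_power mult_ac)
    also have "\<dots> \<le> (C * d i)\<^sup>2"
      using K[of i] i k pos v_eq by (intro power_mono) auto
    finally have "a / C\<^sup>2 * v (k + Suc m) powr (2 * \<theta>) \<le> a / C\<^sup>2 * (C * d i)\<^sup>2"
      using a_pos by (intro mult_left_mono) auto
    also have "\<dots> = a * (d i)\<^sup>2"
      using C_pos by (simp add: power_mult_distrib)
    finally show ?thesis
      using descent[of i] max_antimono[OF i(2)] v_eq by (simp add: v_def)
  qed
  then show ?thesis
    unfolding eventually_sequentially by blast
qed

text \<open>The set \<open>S\<close> stands for \<open>K2 \<union> K31\<close>; the alternatives for \<open>j \<notin> S\<close> are \<open>j \<notin> K1\<close> and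
  \<open>j \<in> K1\<close> with both inequalities defining \<open>K2\<close> and \<open>K31\<close> violated.\<close>

lemma step_bound:
  fixes S :: "nat set"
  assumes \<theta>: "0 < \<theta>" "\<theta> < 1"
    and S: "\<And>j. j \<in> S \<Longrightarrow> a / 2 * (d j)\<^sup>2 \<le> window_max f m (Suc j) - f (Suc j)"
    and not_S: "\<And>j. j \<notin> S \<Longrightarrow> window_max f m (Suc j) - f (Suc j) < a / 2 * (d j)\<^sup>2 \<or>
      a / 2 * d j powr (1 / \<theta>) \<le> window_max f m (Suc j) - f (Suc j) \<and>
      L - f (Suc j) \<le> a / 4 * d j powr (1 / \<theta>)"
  shows "\<exists>A>0. \<exists>B>0. \<forall>j. d j \<le> A * (if j \<in> S then sqrt (window_max f m (Suc j) - f (Suc j)) else 0)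
           + B * (v j powr \<theta> + (v j powr (1 - \<theta>) - v (Suc j) powr (1 - \<theta>)))"
proof -
  define g where "g j = window_max f m (Suc j) - f (Suc j)" for j
  define D where "D j = v j powr (1 - \<theta>) - v (Suc j) powr (1 - \<theta>)" for j
  \<comment> \<open>\<open>A\<close> results from solving
    \<open>a / 2 * (d j)\<^sup>2 \<le> y\<close> for \<open>d j\<close>; the summands of
    \<open>B\<close> come from the second and the third case below.\<close>
  define A where "A = sqrt (2 / a)"
  define B where "B = A / (1 - \<theta>) + (4 / a) powr \<theta>"
  have pos: "A > 0" "B > 0" "B \<ge> A / (1 - \<theta>)" "B \<ge> (4 / a) powr \<theta>"
    using a_pos \<theta> by (auto simp: A_def B_def intro!: add_pos_nonneg)
  have D: "D j \<ge> 0" for j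
    using v_nonneg v_Suc_le \<theta> by (auto simp: D_def intro!: powr_mono2)
  have d_le: "d j \<le> A * sqrt y" if "a / 2 * (d j)\<^sup>2 \<le> y" for j y
  proof -
    have "(d j)\<^sup>2 \<le> 2 / a * y"
      using that a_pos by (simp add: field_simps)
    then have "d j \<le> sqrt (2 / a * y)"
      using d_nonneg by (simp add: real_le_rsqrt)
    then show ?thesis by (simp add: A_def flip: real_sqrt_mult)
  qed
  have "d j \<le> A * (if j \<in> S then sqrt (g j) else 0) + B * (v j powr \<theta> + D j)" for j
  proof -
    consider "j \<in> S" | "j \<notin> S" "g j < a / 2 * (d j)\<^sup>2"
      | "j \<notin> S" "a / 2 * d j powr (1 / \<theta>) \<le> g j" "L - f (Suc j) \<le> a / 4 * d j powr (1 / \<theta>)"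
      using not_S[of j] unfolding g_def by blast
    then show ?thesis
    proof cases
      case 1
      have "0 \<le> B * (v j powr \<theta> + D j)"
        using pos D by simp
      then show ?thesis
        using d_le[OF S[OF 1]] 1 by (simp add: g_def)
    next
      \<comment> \<open>Descent gives a d^2 \<le> (v j - v (Suc j)) + g j. As \<open>g j\<close>
        covers less than half of the left side, the decrease of \<open>v\<close> covers at least the
        other half.\<close>
      case 2
      then have "d j \<le> A * sqrt (v j - v (Suc j))"
        using descent[of j] by (intro d_le) (simp add: g_def v_def)
      also have "\<dots> \<le> A * (v j powr \<theta> + D j / (1 - \<theta>))"
        unfolding D_def using pos \<theta> v_nonneg v_Suc_le by (intro mult_left_mono sqrt_diff_le) auto
      also have "\<dots> \<le> A * (v j powr \<theta> / (1 - \<theta>) + D j / (1 - \<theta>))"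
        using pos \<theta> by (intro mult_left_mono add_right_mono) (auto simp: field_simps)
      also have "\<dots> = A / (1 - \<theta>) * (v j powr \<theta> + D j)"
        by (simp add: algebra_simps add_divide_distrib)
      also have "\<dots> \<le> B * (v j powr \<theta> + D j)"
        using pos D by (intro mult_right_mono) auto
      finally show ?thesis using 2 by simp
    next
      \<comment> \<open>Since g j - (L - f (Suc j)) = v (Suc j), the two inequalities of this case
        leave a lower bound a/4 d^(1/\<theta>) for \<open>v (Suc j)\<close>.\<close>
      case 3
      have "d j powr (1 / \<theta>) \<le> 4 / a * v (Suc j)"
        using 3 a_pos by (simp add: g_def v_def field_simps)
      then have "(d j powr (1 / \<theta>)) powr \<theta> \<le> (4 / a * v (Suc j)) powr \<theta>"
        using \<theta> by (intro powr_mono2) auto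
      then have "d j \<le> (4 / a * v (Suc j)) powr \<theta>"
        using \<theta> d_nonneg by (simp add: powr_powr)
      also have "\<dots> = (4 / a) powr \<theta> * v (Suc j) powr \<theta>"
        by (rule powr_mult)
      also have "\<dots> \<le> B * (v j powr \<theta> + D j)"
      proof (intro mult_mono)
        have "v (Suc j) powr \<theta> \<le> v j powr \<theta>"
          using v_nonneg v_Suc_le \<theta> by (intro powr_mono2) auto
        then show "v (Suc j) powr \<theta> \<le> v j powr \<theta> + D j"
          using D[of j] by simp
      qed (use pos in auto)
      finally show ?thesis using 3 by simp
    qed
  qed
  then show ?thesis
    using pos unfolding g_def D_def by blast
qed

text \<open>Summing \<open>step_bound\<close> gives three parts: the one over \<open>S\<close> is
  bounded by hypothesis, the powers with exponent \<theta> are bounded by differences of rates, and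
  the remaining differences telescope by themselves. Bounds on partial sums uniform in
  \<open>N\<close> yield both summability and the tail estimate.\<close>

lemma length_rate:
  fixes S :: "nat set"
  defines "s \<equiv> \<lambda>j. sqrt (window_max f m (Suc j) - f (Suc j))"
  assumes \<theta>: "0 < \<theta>" "\<theta> < 1"
    and S: "\<And>j. j \<in> S \<Longrightarrow> a / 2 * (d j)\<^sup>2 \<le> window_max f m (Suc j) - f (Suc j)"
    and not_S: "\<And>j. j \<notin> S \<Longrightarrow> window_max f m (Suc j) - f (Suc j) < a / 2 * (d j)\<^sup>2 \<or>
      a / 2 * d j powr (1 / \<theta>) \<le> window_max f m (Suc j) - f (Suc j) \<and>
      L - f (Suc j) \<le> a / 4 * d j powr (1 / \<theta>)"
    and \<gamma>\<tau>: "0 < \<gamma>" "0 < \<tau>" "\<tau> < 1"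
    and s_summable: "\<And>k. k \<ge> k0 \<Longrightarrow> s summable_on {j \<in> S. j \<ge> k}"
    and s_rate: "\<And>k. k \<ge> k0 \<Longrightarrow> infsum s {j \<in> S. j \<ge> k} \<le> rate \<theta> \<gamma> \<tau> k"
  shows "summable d \<and> (\<exists>\<gamma> \<rho>. 0 < \<gamma> \<and> 0 < \<rho> \<and> \<rho> < 1 \<and>
           (\<forall>\<^sub>F k in sequentially. (\<Sum>i. d (k + i)) \<le> rate \<theta> \<gamma> \<rho> k))"
proof -
  obtain A B where AB: "A > 0" "B > 0"
      and step: "\<And>j. d j \<le> A * (if j \<in> S then s j else 0)
           + B * (v j powr \<theta> + (v j powr (1 - \<theta>) - v (Suc j) powr (1 - \<theta>)))"
    using step_bound[OF \<theta> S not_S] unfolding s_def by blast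
  obtain \<gamma>' \<sigma> where \<gamma>'\<sigma>: "0 < \<gamma>'" "0 < \<sigma>" "\<sigma> < 1"
      and ev: "\<forall>\<^sub>F k in sequentially.
           v k powr \<theta> \<le> rate \<theta> \<gamma>' \<sigma> k - rate \<theta> \<gamma>' \<sigma> (Suc k) \<and> v k powr (1 - \<theta>) \<le> rate \<theta> \<gamma>' \<sigma> k"
    using recursion_rate[OF \<theta> _ _ v_nonneg v_lim v_recursion] a_pos C_pos by auto
  then obtain K where
      K: "\<And>k. k \<ge> K \<Longrightarrow> v k powr \<theta> \<le> rate \<theta> \<gamma>' \<sigma> k - rate \<theta> \<gamma>' \<sigma> (Suc k)"
         "\<And>k. k \<ge> K \<Longrightarrow> v k powr (1 - \<theta>) \<le> rate \<theta> \<gamma>' \<sigma> k"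
    by (auto simp: eventually_sequentially)
  define \<rho> where "\<rho> = max \<tau> \<sigma>"
  define G where "G = A * \<gamma> + 2 * B * \<gamma>'"
  have s_nonneg: "0 \<le> s j" for j
    by (auto simp: s_def intro!: window_max_ge)
  have partial: "(\<Sum>i<N. d (k + i)) \<le> rate \<theta> G \<rho> k" if k: "k \<ge> max K k0" for k N
  proof -
    \<comment> \<open>\<open>R\<close> merges both telescoping sources; \<open>R k\<close> is at
      most twice the rate, whence the factor 2 in \<open>G\<close>.\<close>
    define R where "R j = rate \<theta> \<gamma>' \<sigma> j + v j powr (1 - \<theta>)" for j
    have R_nonneg: "R j \<ge> 0" for j
      using \<gamma>'\<sigma> by (simp add: R_def rate_nonneg)
    \<comment> \<open>Reindexing by j = k + i exhibits a finite subsum of the unordered sum in the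
      hypothesis, whose terms are nonnegative.\<close>
    have "(\<Sum>i<N. if k + i \<in> S then s (k + i) else 0) = (\<Sum>j\<in>(+) k ` {..<N}. if j \<in> S then s j else 0)"
      by (simp add: sum.reindex)
    also have "\<dots> = sum s ((+) k ` {..<N} \<inter> S)"
      by (simp add: sum.inter_restrict)
    also have "\<dots> \<le> infsum s {j \<in> S. j \<ge> k}"
      using k s_nonneg by (intro finite_sum_le_infsum s_summable) auto
    also have "\<dots> \<le> rate \<theta> \<gamma> \<tau> k"
      using k s_rate by simp
    finally have 1: "(\<Sum>i<N. if k + i \<in> S then s (k + i) else 0) \<le> rate \<theta> \<gamma> \<tau> k" .
    have "(\<Sum>i<N. v (k + i) powr \<theta> + (v (k + i) powr (1 - \<theta>) - v (Suc (k + i)) powr (1 - \<theta>)))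
        \<le> (\<Sum>i<N. R (k + i) - R (k + Suc i))"
      using K(1) k by (intro sum_mono) (simp add: R_def)
    also have "\<dots> = R k - R (k + N)"
      by (subst sum_lessThan_telescope') simp
    also have "\<dots> \<le> 2 * rate \<theta> \<gamma>' \<sigma> k"
      using R_nonneg[of "k + N"] K(2)[of k] k by (simp add: R_def)
    finally have 2: "(\<Sum>i<N. v (k + i) powr \<theta> + (v (k + i) powr (1 - \<theta>) - v (Suc (k + i)) powr (1 - \<theta>)))
        \<le> 2 * rate \<theta> \<gamma>' \<sigma> k" .
    have "(\<Sum>i<N. d (k + i)) \<le> A * (\<Sum>i<N. if k + i \<in> S then s (k + i) else 0) +
        B * (\<Sum>i<N. v (k + i) powr \<theta> + (v (k + i) powr (1 - \<theta>) - v (Suc (k + i)) powr (1 - \<theta>)))"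
      unfolding sum_distrib_left sum.distrib[symmetric] by (intro sum_mono step)
    also have "\<dots> \<le> A * rate \<theta> \<gamma> \<tau> k + B * (2 * rate \<theta> \<gamma>' \<sigma> k)"
      using 1 2 AB by (intro add_mono mult_left_mono) auto
    also have "\<dots> \<le> A * rate \<theta> \<gamma> \<rho> k + B * (2 * rate \<theta> \<gamma>' \<rho> k)"
      using AB \<gamma>\<tau> \<gamma>'\<sigma> by (intro add_mono mult_left_mono rate_mono) (auto simp: \<rho>_def)
    also have "\<dots> = rate \<theta> G \<rho> k"
      by (simp add: rate_scale rate_add G_def mult_ac)
    finally show ?thesis .
  qed
  have "summable (\<lambda>i. d (i + max K k0))"
    using partial[of "max K k0"] d_nonneg by (intro summableI_nonneg_bounded) (auto simp: add.commute)
  then have sum: "summable d"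
    by (subst (asm) summable_iff_shift)
  have "(\<Sum>i. d (k + i)) \<le> rate \<theta> G \<rho> k" if "k \<ge> max K k0" for k
    using partial[OF that] sum summable_iff_shift[of d k]
    by (intro suminf_le_const) (auto simp: add.commute)
  then have "\<forall>\<^sub>F k in sequentially. (\<Sum>i. d (k + i)) \<le> rate \<theta> G \<rho> k"
    unfolding eventually_sequentially by blast
  moreover have "0 < G" "0 < \<rho>" "\<rho> < 1"
    using AB \<gamma>\<tau> \<gamma>'\<sigma> by (auto simp: G_def \<rho>_def add_pos_pos)
  ultimately show ?thesis using sum by blast
qed

end

subsection \<open>Subdifferentials and the KL property\<close>

text \<open>The definition uses punctured neighbourhoods, whereas the sequence may hit
  \<open>z\<close>. Every bound below \<Phi> z holds at \<open>z\<close> itself, so it extends to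
  full neighbourhoods.\<close>

lemma lower_semicontinuous_sequentially:
  assumes "lower_semicontinuous \<Phi>" and y: "y \<longlonglongrightarrow> z"
  shows "\<Phi> z \<le> liminf (\<lambda>j. \<Phi> (y j))"
proof -
  have "\<forall>\<^sub>F j in sequentially. C < \<Phi> (y j)" if "C < \<Phi> z" for C
  proof -
    have "\<forall>\<^sub>F u in at z. C < \<Phi> u"
      using assms(1) that by (auto simp: lower_semicontinuous_def le_Liminf_iff)
    then have "\<forall>\<^sub>F u in nhds z. C < \<Phi> u"
      using that by (auto simp: eventually_at_filter elim!: eventually_mono)
    then show ?thesis
      using y by (auto simp: filterlim_iff)
  qed
  then show ?thesis by (auto simp: le_Liminf_iff)
qed

lemma coercive_sublevel_bounded:
  assumes "coercive \<Phi>"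
  shows "bounded {y. \<Phi> y \<le> ereal r}"
proof -
  have "\<forall>\<^sub>F y in at_infinity. ereal r < \<Phi> y"
    using order_tendstoD(1)[OF assms[unfolded coercive_def], of "ereal r"] by simp
  then obtain B where B: "\<And>y. norm y \<ge> B \<Longrightarrow> ereal r < \<Phi> y"
    by (auto simp: eventually_at_infinity)
  have "norm y \<le> B" if "\<Phi> y \<le> ereal r" for y
    using B[of y] that by (meson linorder_not_le order_le_less_trans nle_le)
  then show ?thesis by (auto simp: bounded_iff)
qed

text \<open>The sequential definition is recast as a closure of the graph of triples (point, value,
  subgradient), so that closedness comes from topology.\<close>

lemma mem_limiting_subdifferential_iff:
  "v \<in> limiting_subdifferential \<Phi> x \<longleftrightarrow>
     x \<in> dom \<Phi> \<and> (x, \<Phi> x, v) \<in> closure {(y, \<Phi> y, u) |y u. u \<in> frechet_subdifferential \<Phi> y}"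
    (is "_ \<longleftrightarrow> _ \<and> _ \<in> closure ?G")
proof -
  have "(\<exists>y u. y \<longlonglongrightarrow> x \<and> (\<lambda>n. \<Phi> (y n)) \<longlonglongrightarrow> \<Phi> x \<and>
          (\<forall>n. u n \<in> frechet_subdifferential \<Phi> (y n)) \<and> u \<longlonglongrightarrow> v) \<longleftrightarrow> (x, \<Phi> x, v) \<in> closure ?G"
    (is "?l \<longleftrightarrow> ?r")
  proof
    assume ?l
    then obtain y u where yu: "y \<longlonglongrightarrow> x" "(\<lambda>n. \<Phi> (y n)) \<longlonglongrightarrow> \<Phi> x" "u \<longlonglongrightarrow> v"
        "\<And>n. u n \<in> frechet_subdifferential \<Phi> (y n)"
      by blast
    then have "(\<lambda>n. (y n, \<Phi> (y n), u n)) \<longlonglongrightarrow> (x, \<Phi> x, v)"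
      by (intro tendsto_Pair)
    moreover have "(y n, \<Phi> (y n), u n) \<in> ?G" for n
      using yu(4) by blast
    ultimately show ?r
      unfolding closure_sequential by (intro exI[of _ "\<lambda>n. (y n, \<Phi> (y n), u n)"]) blast
  next
    assume ?r
    then obtain g where g: "\<And>n. g n \<in> ?G" "g \<longlonglongrightarrow> (x, \<Phi> x, v)"
      unfolding closure_sequential by blast
    define y u where "y n = fst (g n)" and "u n = snd (snd (g n))" for n
    have "fst (snd (g n)) = \<Phi> (y n)" "u n \<in> frechet_subdifferential \<Phi> (y n)" for n
      using g(1)[of n] by (auto simp: y_def u_def)
    then show ?l
      using tendsto_fst[OF g(2)] tendsto_fst[OF tendsto_snd[OF g(2)]] tendsto_snd[OF tendsto_snd[OF g(2)]]
      unfolding y_def u_def by (intro exI[of _ "\<lambda>n. fst (g n)"] exI[of _ "\<lambda>n. snd (snd (g n))"]) simp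
  qed
  then show ?thesis by (simp add: limiting_subdifferential_def)
qed

text \<open>The diagonal sequence of a direct argument is absorbed by the fact that a closure is
  closed.\<close>

lemma limiting_subdifferential_closed:
  assumes "x \<in> dom \<Phi>" "y \<longlonglongrightarrow> x" "(\<lambda>n. \<Phi> (y n)) \<longlonglongrightarrow> \<Phi> x" "u \<longlonglongrightarrow> v"
    and "\<And>n. u n \<in> limiting_subdifferential \<Phi> (y n)"
  shows "v \<in> limiting_subdifferential \<Phi> x"
proof -
  have "(\<lambda>n. (y n, \<Phi> (y n), u n)) \<longlonglongrightarrow> (x, \<Phi> x, v)"
    using assms by (intro tendsto_Pair)
  moreover have "(y n, \<Phi> (y n), u n) \<in> closure {(y, \<Phi> y, u) |y u. u \<in> frechet_subdifferential \<Phi> y}" for n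
    using assms(5)[of n] unfolding mem_limiting_subdifferential_iff by (rule conjunct2)
  ultimately have "(x, \<Phi> x, v) \<in> closure {(y, \<Phi> y, u) |y u. u \<in> frechet_subdifferential \<Phi> y}"
    by (rule closed_sequentially[OF closed_closure, rotated])
  then show ?thesis
    using assms(1) by (simp add: mem_limiting_subdifferential_iff)
qed

lemma frequently_subsequence:
  assumes "\<not> (\<forall>\<^sub>F k in sequentially. P k)"
  shows "\<exists>r::nat \<Rightarrow> nat. strict_mono r \<and> (\<forall>j. \<not> P (r j))"
proof -
  have inf: "infinite {k. \<not> P k}"
    using assms by (simp add: eventually_cofinite flip: cofinite_eq_sequentially)
  show ?thesis
    using strict_mono_enumerate[OF inf] enumerate_in_set[OF inf]
    by (intro exI[of _ "enumerate {k. \<not> P k}"]) simp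
qed

text \<open>A sequence of violations would have a cluster point, at which the KL property fails.\<close>

lemma KL_eventually:
  fixes \<Phi> :: "'a::euclidean_space \<Rightarrow> ereal"
  assumes KL: "KL_function \<Phi> (\<lambda>t. c * t powr (1 - \<theta>))" and c: "c > 0" and \<theta>: "\<theta> < 1"
    and bdd: "bounded (range x)"
    and f: "\<And>k. \<Phi> (x k) = ereal (f k)" and f_lim: "f \<longlonglongrightarrow> L"
    and cluster: "\<And>z. z \<in> cluster_points x \<Longrightarrow> \<Phi> z = ereal L \<and> limiting_subdifferential \<Phi> z \<noteq> {}"
    and w: "\<And>k. w k \<in> limiting_subdifferential \<Phi> (x k)"
  shows "\<forall>\<^sub>F k in sequentially. L < f k \<longrightarrow> (f k - L) powr \<theta> \<le> c * (1 - \<theta>) * norm (w k)"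
proof (rule ccontr)
  assume "\<not> ?thesis"
  then obtain r :: "nat \<Rightarrow> nat" where r: "strict_mono r"
      and bad: "\<And>j. \<not> (L < f (r j) \<longrightarrow> (f (r j) - L) powr \<theta> \<le> c * (1 - \<theta>) * norm (w (r j)))"
    using frequently_subsequence by blast
  have "bounded (range (x \<circ> r))"
    using bdd by (rule bounded_subset) auto
  then obtain s z where s: "strict_mono s" "((x \<circ> r) \<circ> s) \<longlonglongrightarrow> z"
    using bounded_imp_convergent_subsequence by blast
  have rs: "strict_mono (r \<circ> s)"
    using r s(1) by (rule strict_mono_o)
  have lim: "(\<lambda>j. x ((r \<circ> s) j)) \<longlonglongrightarrow> z"
    using s(2) by (simp add: o_def)
  then have "z \<in> cluster_points x"
    using rs unfolding cluster_points_def by blast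
  note z = cluster[OF this]
  obtain \<eta> U where \<eta>U: "0 < \<eta>" "open U" "z \<in> U"
      and KL_z: "\<forall>y\<in>U. ereal L < \<Phi> y \<and> \<Phi> y < ereal L + \<eta> \<longrightarrow>
         1 \<le> ereal (deriv (\<lambda>t. c * t powr (1 - \<theta>)) (real_of_ereal (\<Phi> y - ereal L)))
              * edist_to 0 (limiting_subdifferential \<Phi> y)"
    using KL[unfolded KL_function_def, rule_format, OF conjunct2[OF z]] unfolding conjunct1[OF z]
    by (elim exE conjE) (rule that)
  have "(\<lambda>j. ereal (f ((r \<circ> s) j))) \<longlonglongrightarrow> ereal L"
    using LIMSEQ_subseq_LIMSEQ[OF f_lim rs] by (simp add: o_def)
  \<comment> \<open>As \<open>L\<close> is real, this is strict for \<eta> = \<infinity> as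
    well.\<close>
  moreover have "ereal L < ereal L + \<eta>"
    using \<eta>U(1) by (cases \<eta>) auto
  ultimately have "\<forall>\<^sub>F j in sequentially. ereal (f ((r \<circ> s) j)) < ereal L + \<eta>"
    by (rule order_tendstoD(2))
  moreover have "\<forall>\<^sub>F j in sequentially. x ((r \<circ> s) j) \<in> U"
    using lim \<eta>U(2,3) by (rule topological_tendstoD)
  ultimately have "\<forall>\<^sub>F j in sequentially. ereal (f ((r \<circ> s) j)) < ereal L + \<eta> \<and> x ((r \<circ> s) j) \<in> U"
    by (rule eventually_conj)
  then obtain j where j: "ereal (f ((r \<circ> s) j)) < ereal L + \<eta>" "x ((r \<circ> s) j) \<in> U"
    unfolding eventually_sequentially by blast
  define k where "k = (r \<circ> s) j"
  have k: "L < f k" "c * (1 - \<theta>) * norm (w k) < (f k - L) powr \<theta>"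
    using bad[of "s j"] by (auto simp: k_def)
  define t where "t = f k - L"
  have t: "t > 0" using k by (simp add: t_def)
  have "((\<lambda>t. c * t powr (1 - \<theta>)) has_real_derivative c * ((1 - \<theta>) * t powr (1 - \<theta> - 1))) (at t)"
    using t by (intro DERIV_cmult has_real_derivative_powr)
  then have deriv: "deriv (\<lambda>t. c * t powr (1 - \<theta>)) t = c * (1 - \<theta>) * t powr (- \<theta>)"
    by (simp add: DERIV_imp_deriv)
  have "1 \<le> ereal (c * (1 - \<theta>) * t powr (- \<theta>)) * edist_to 0 (limiting_subdifferential \<Phi> (x k))"
    using KL_z[rule_format, of "x k"] j k(1) f[of k] deriv by (simp add: k_def t_def)
  \<comment> \<open>The distance is an infimum, hence at most the norm of the particular subgradient
    \<open>w k\<close>.\<close>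
  also have "\<dots> \<le> ereal (c * (1 - \<theta>) * t powr (- \<theta>)) * ereal (norm (w k))"
    using c \<theta> w[of k]
    by (intro ereal_mult_left_mono) (auto simp: edist_to_def intro!: INF_lower2[of "w k"])
  finally have "1 \<le> c * (1 - \<theta>) * t powr (- \<theta>) * norm (w k)"
    by (simp add: one_ereal_def)
  also have "\<dots> = (c * (1 - \<theta>) * norm (w k)) * t powr (- \<theta>)"
    by simp
  also have "\<dots> < t powr \<theta> * t powr (- \<theta>)"
    using k(2) t unfolding t_def by (intro mult_strict_right_mono) auto
  also have "\<dots> = 1"
    using t by (simp flip: powr_add)
  finally show False by simp
qed

section \<open>Convergence from summable step lengths\<close>

lemma norm_limit_diff_le_Delta:
  fixes x :: "nat \<Rightarrow> 'a::banach"
  assumes sum: "summable (\<lambda>j. norm (x (j + 1) - x j))" and lim: "x \<longlonglongrightarrow> z"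
  shows "norm (x k - z) \<le> Delta x k"
proof -
  have "(\<lambda>i. x (k + i)) \<longlonglongrightarrow> z"
    using LIMSEQ_ignore_initial_segment[OF lim, of k] by (simp add: add.commute)
  from telescope_sums[OF this]
  have sums: "(\<lambda>i. x (k + i + 1) - x (k + i)) sums (z - x k)" by simp
  have "summable (\<lambda>i. norm (x (k + i + 1) - x (k + i)))"
    using summable_ignore_initial_segment[OF sum, of k] by (simp add: add_ac)
  then have "norm (\<Sum>i. x (k + i + 1) - x (k + i)) \<le> Delta x k"
    unfolding Delta_def by (rule summable_norm)
  then show ?thesis
    using sums_unique[OF sums] by (simp add: norm_minus_commute)
qed

lemma convergent_if_summable_steps:
  fixes x :: "nat \<Rightarrow> 'a::banach"
  assumes "summable (\<lambda>j. norm (x (j + 1) - x j))"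
  shows "\<exists>z. x \<longlonglongrightarrow> z"
proof -
  have "summable (\<lambda>j. x (j + 1) - x j)"
    using assms by (rule summable_norm_cancel)
  then have "(\<lambda>n. (\<Sum>j<n. x (j + 1) - x j) + x 0) \<longlonglongrightarrow> (\<Sum>j. x (j + 1) - x j) + x 0"
    by (intro tendsto_intros summable_LIMSEQ)
  then show ?thesis
    using sum_lessThan_telescope[of x] by auto
qed

lemma tendsto_imp_cluster_point: "x \<longlonglongrightarrow> z \<Longrightarrow> z \<in> cluster_points x"
  unfolding cluster_points_def by (intro CollectI exI[of _ id]) (simp add: strict_mono_def)

text \<open>Bridge from the argmax of extended values to the real window maxima: the selected index
  belongs to the finite nonempty set of maximisers.\<close>

lemma ell_attains_window_max:
  assumes f: "\<And>k. \<Phi> (x k) = ereal (f k)"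
  shows "\<Phi> (x (ell \<Phi> x m k)) = ereal (window_max f m k)"
proof -
  define A where "A = {i. is_arg_max (\<lambda>j. \<Phi> (x j)) (\<lambda>j. j \<in> {k - m..k}) i}"
  have A: "A = {i \<in> {k - m..k}. f i = window_max f m k}"
  proof -
    obtain j where j: "j \<in> {k - m..k}" "window_max f m k = f j"
      using window_max_attained by blast
    have "i \<in> A \<longleftrightarrow> i \<in> {k - m..k} \<and> f i = window_max f m k" for i
    proof
      assume "i \<in> A"
      then have "i \<in> {k - m..k}" "f j \<le> f i"
        using j(1) by (auto simp: A_def is_arg_max_linorder f)
      then show "i \<in> {k - m..k} \<and> f i = window_max f m k"
        using j(2) window_max_ge[of k m i f] by simp
    next
      assume "i \<in> {k - m..k} \<and> f i = window_max f m k"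
      then show "i \<in> A"
        using window_max_ge[of k m _ f] by (auto simp: A_def is_arg_max_linorder f)
    qed
    then show ?thesis by blast
  qed
  have "Max A \<in> A"
    using window_max_attained[of k m f] unfolding A by (intro Max_in) auto
  moreover have "ell \<Phi> x m k = Max A"
    by (simp add: ell_def A_def)
  ultimately show ?thesis
    by (simp add: A f)
qed

theorem theorem3p9:
  fixes \<Phi> :: "'a::euclidean_space \<Rightarrow> ereal"
    and x :: "nat \<Rightarrow> 'a"
    and m :: nat
    and a b c \<theta> :: real
  assumes "proper \<Phi>" "lower_semicontinuous \<Phi>" "coercive \<Phi>" "bounded_below \<Phi>"
    and "a > 0" "b > 0"
    and H1: "\<And>k. \<Phi> (x (k + 1)) + ereal (a * norm (x (k + 1) - x k) ^ 2)
                 \<le> Max ((\<lambda>j. \<Phi> (x j)) ` {k - m..k})"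
    and H2: "\<exists>w. \<forall>k. w k \<in> limiting_subdifferential \<Phi> (x k) \<and>
                    norm (w (k + 1)) \<le> b * norm (x (k + 1) - x k)"
    and "0 \<le> \<theta>" "\<theta> < 1" "c > 0"
    and "KL_function \<Phi> (\<lambda>t. c * t powr (1 - \<theta>))"
    and "liminf (\<lambda>k. \<Phi> (x k)) \<ge> lim (\<lambda>k. \<Phi> (x (ell \<Phi> x m k)))"
    and "\<And>(r :: nat \<Rightarrow> nat) xhat. strict_mono r \<Longrightarrow> (\<lambda>j. x (r j)) \<longlonglongrightarrow> xhat \<Longrightarrow>
           limsup (\<lambda>j. \<Phi> (x (r j))) \<le> \<Phi> xhat"
  shows "(\<exists>L::real. (\<lambda>k. \<Phi> (x k)) \<longlonglongrightarrow> ereal L) \<and>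
    (\<theta> = 0 \<longrightarrow> (\<exists>xt \<in> cluster_points x. \<forall>\<^sub>F k in sequentially. x k = xt)) \<and>
    (0 < \<theta> \<and>
      (\<exists>k0 \<gamma> \<tau>. 0 < \<gamma> \<and> 0 < \<tau> \<and> \<tau> < 1 \<and>
        (\<forall>k\<ge>k0.
          (\<lambda>j. sqrt (real_of_ereal (gap \<Phi> x m (j + 1))))
             summable_on {j \<in> K2 \<Phi> x m a \<theta> \<union> K31 \<Phi> x m a \<theta>. j \<ge> k} \<and>
          (\<Sum>\<^sub>\<infinity>j \<in> {j \<in> K2 \<Phi> x m a \<theta> \<union> K31 \<Phi> x m a \<theta>. j \<ge> k}.
             sqrt (real_of_ereal (gap \<Phi> x m (j + 1)))) \<le> rate \<theta> \<gamma> \<tau> k))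
      \<longrightarrow>
      (\<exists>xt \<in> cluster_points x. x \<longlonglongrightarrow> xt \<and>
        summable (\<lambda>j. norm (x (j + 1) - x j)) \<and>
        (\<exists>\<gamma> \<rho>. 0 < \<gamma> \<and> 0 < \<rho> \<and> \<rho> < 1 \<and>
          (\<forall>\<^sub>F k in sequentially.
             norm (x k - xt) \<le> Delta x k \<and> Delta x k \<le> rate \<theta> \<gamma> \<rho> k))))"
proof -

  \<comment> \<open>Reduction to real sequences and the KL inequality along the iterates\<close>
  obtain w where w: "\<And>k. w k \<in> limiting_subdifferential \<Phi> (x k)"
      and w_le: "\<And>k. norm (w (k + 1)) \<le> b * norm (x (k + 1) - x k)"
    using H2 by blast
  define f where "f k = real_of_ereal (\<Phi> (x k))" for k
  define d where "d k = norm (x (k + 1) - x k)" for k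
  \<comment> \<open>A limiting subgradient exists only at points of the domain, which excludes
    \<infinity>; properness excludes -\<infinity>.\<close>
  have f: "\<Phi> (x k) = ereal (f k)" for k
    using w[of k] \<open>proper \<Phi>\<close>
    by (cases "\<Phi> (x k)") (auto simp: f_def limiting_subdifferential_def dom_def proper_def)
  have descent: "f (Suc k) + a * (d k)\<^sup>2 \<le> window_max f m k" for k
  proof -
    have "Max ((\<lambda>j. \<Phi> (x j)) ` {k - m..k}) \<le> ereal (window_max f m k)"
      using window_max_ge[of k m _ f] by (intro Max.boundedI) (auto simp: f)
    from order_trans[OF H1 this] show ?thesis
      by (simp add: f d_def)
  qed
  have decseq: "decseq (window_max f m)"
    using \<open>a > 0\<close> descent by (intro window_max_decseq[where a = a and d = d]) auto
  have f_le: "f k \<le> window_max f m k" for k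
    by (intro window_max_ge) auto
  obtain r where "\<And>y. ereal r \<le> \<Phi> y"
    using \<open>bounded_below \<Phi>\<close> by (auto simp: bounded_below_def)
  then have "r \<le> f k" for k
    using f by (metis ereal_less_eq(3))
  then have "\<forall>k. r \<le> window_max f m k"
    using f_le order_trans by blast
  then obtain L where max_lim: "window_max f m \<longlonglongrightarrow> L"
    using decseq_convergent[OF decseq] by blast
  note ell = ell_attains_window_max[of \<Phi> x f m, OF f]
  have "lim (\<lambda>k. \<Phi> (x (ell \<Phi> x m k))) = ereal L"
    unfolding ell using max_lim by (intro limI tendsto_intros)
  then have liminf_ge: "ereal L \<le> liminf (\<lambda>k. ereal (f k))"
    using assms(13) by (simp add: f)
  \<comment> \<open>The liminf hypothesis bounds the values from below, and the window maxima
    dominate them from above.\<close>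
  have ereal_lim: "(\<lambda>k. ereal (f k)) \<longlonglongrightarrow> ereal L"
  proof (rule order_tendstoI)
    show "\<forall>\<^sub>F k in sequentially. y < ereal (f k)" if "y < ereal L" for y
      using liminf_ge that by (auto simp: le_Liminf_iff)
    show "\<forall>\<^sub>F k in sequentially. ereal (f k) < y" if "ereal L < y" for y
    proof -
      have "(\<lambda>k. ereal (window_max f m k)) \<longlonglongrightarrow> ereal L"
        using max_lim by (intro tendsto_intros)
      from order_tendstoD(2)[OF this that] show ?thesis
        by eventually_elim (metis f_le ereal_less_eq(3) order_le_less_trans)
    qed
  qed
  then have f_lim: "f \<longlonglongrightarrow> L" by simp
  interpret nonmonotone_descent f d m a L
    using \<open>a > 0\<close> descent f_lim max_lim by unfold_locales (auto simp: d_def)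
  have "range x \<subseteq> {y. \<Phi> y \<le> ereal (window_max f m 0)}"
    using order_trans[OF f_le max_antimono[OF le0]] by (auto simp: f)
  then have bdd: "bounded (range x)"
    using coercive_sublevel_bounded[OF \<open>coercive \<Phi>\<close>] bounded_subset by blast
  \<comment> \<open>Vanishing subgradients make 0 a limiting subgradient at every cluster point, so
    the KL property is available there.\<close>
  have "w \<longlonglongrightarrow> 0"
  proof (rule LIMSEQ_imp_Suc, rule Lim_null_comparison)
    show "\<forall>\<^sub>F k in sequentially. norm (w (Suc k)) \<le> b * d k"
      using w_le by (simp add: d_def)
    show "(\<lambda>k. b * d k) \<longlonglongrightarrow> 0"
      using tendsto_mult_left[OF d_lim, of b] by simp
  qed
  have cluster: "\<Phi> z = ereal L \<and> limiting_subdifferential \<Phi> z \<noteq> {}" if z: "z \<in> cluster_points x" for z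
  proof -
    obtain r :: "nat \<Rightarrow> nat" where r: "strict_mono r" "(\<lambda>j. x (r j)) \<longlonglongrightarrow> z"
      using z unfolding cluster_points_def by blast
    have lim: "(\<lambda>j. \<Phi> (x (r j))) \<longlonglongrightarrow> ereal L"
      using LIMSEQ_subseq_LIMSEQ[OF ereal_lim r(1)] by (simp add: o_def f)
    \<comment> \<open>Lower semicontinuity gives one inequality, the limsup hypothesis on
      subsequences the other.\<close>
    have \<Phi>_z: "\<Phi> z = ereal L"
    proof (rule antisym)
      show "\<Phi> z \<le> ereal L"
        using lower_semicontinuous_sequentially[OF \<open>lower_semicontinuous \<Phi>\<close> r(2)] lim_imp_Liminf[OF _ lim]
        by simp
      show "ereal L \<le> \<Phi> z"
        using assms(14)[OF r] lim_imp_Limsup[OF _ lim] by simp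
    qed
    have "0 \<in> limiting_subdifferential \<Phi> z"
    proof (rule limiting_subdifferential_closed)
      show "(\<lambda>j. w (r j)) \<longlonglongrightarrow> 0"
        using LIMSEQ_subseq_LIMSEQ[OF \<open>w \<longlonglongrightarrow> 0\<close> r(1)] by (simp add: o_def)
    qed (use r lim \<Phi>_z w in \<open>auto simp: dom_def\<close>)
    then show ?thesis using \<Phi>_z by blast
  qed
  have "\<forall>\<^sub>F k in sequentially. L < f k \<longrightarrow> (f k - L) powr \<theta> \<le> c * (1 - \<theta>) * norm (w k)"
    using KL_eventually[OF assms(12) \<open>c > 0\<close> \<open>\<theta> < 1\<close> bdd f f_lim cluster w] .
  then have "\<forall>\<^sub>F k in sequentially. L < f (Suc k) \<longrightarrow>
      (f (Suc k) - L) powr \<theta> \<le> c * (1 - \<theta>) * norm (w (Suc k))"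
    by (rule eventually_sequentially_Suc[THEN iffD2])
  then have KL: "\<forall>\<^sub>F k in sequentially. L < f (Suc k) \<longrightarrow>
      (f (Suc k) - L) powr \<theta> \<le> (c * (1 - \<theta>) * b) * d k"
  proof eventually_elim
    case (elim k)
    have "c * (1 - \<theta>) * norm (w (Suc k)) \<le> c * (1 - \<theta>) * (b * d k)"
      using w_le[of k] \<open>c > 0\<close> \<open>\<theta> < 1\<close> by (intro mult_left_mono) (auto simp: d_def)
    then show ?case
      using elim unfolding mult.assoc by linarith
  qed
  interpret nonmonotone_descent_KL f d m a L "c * (1 - \<theta>) * b" \<theta>
    using KL \<open>b > 0\<close> \<open>c > 0\<close> \<open>\<theta> < 1\<close> by unfold_locales auto

  \<comment> \<open>Finite termination for \<theta> = 0\<close>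
  have finite: "\<exists>xt \<in> cluster_points x. \<forall>\<^sub>F k in sequentially. x k = xt" if \<theta>: "\<theta> = 0"
  proof -
    have "f (Suc k) = f k" if "d k = 0" for k
      using that by (simp add: d_def f_def)
    from finite_termination[OF \<theta> this]
    obtain K where K: "\<And>k. k \<ge> K \<Longrightarrow> d k = 0"
      by (auto simp: eventually_sequentially)
    have "x k = x K" if "k \<ge> K" for k
      using that
    proof (induction rule: dec_induct)
      case (step k)
      then show ?case using K[of k] by (simp add: d_def)
    qed simp
    then have ev: "\<forall>\<^sub>F k in sequentially. x k = x K"
      unfolding eventually_sequentially by blast
    then have "x K \<in> cluster_points x"
      by (intro tendsto_imp_cluster_point tendsto_eventually)
    then show ?thesis using ev by blast
  qed

  \<comment> \<open>Convergence rates for 0 < \<theta> < 1\<close>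
  have rates: "\<exists>xt \<in> cluster_points x. x \<longlonglongrightarrow> xt \<and>
        summable (\<lambda>j. norm (x (j + 1) - x j)) \<and>
        (\<exists>\<gamma> \<rho>. 0 < \<gamma> \<and> 0 < \<rho> \<and> \<rho> < 1 \<and>
          (\<forall>\<^sub>F k in sequentially.
             norm (x k - xt) \<le> Delta x k \<and> Delta x k \<le> rate \<theta> \<gamma> \<rho> k))"
    if \<theta>: "0 < \<theta>" and \<gamma>\<tau>: "0 < \<gamma>" "0 < \<tau>" "\<tau> < 1"
      and tail: "\<forall>k\<ge>k0.
          (\<lambda>j. sqrt (real_of_ereal (gap \<Phi> x m (j + 1))))
             summable_on {j \<in> K2 \<Phi> x m a \<theta> \<union> K31 \<Phi> x m a \<theta>. j \<ge> k} \<and>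
          (\<Sum>\<^sub>\<infinity>j \<in> {j \<in> K2 \<Phi> x m a \<theta> \<union> K31 \<Phi> x m a \<theta>. j \<ge> k}.
             sqrt (real_of_ereal (gap \<Phi> x m (j + 1)))) \<le> rate \<theta> \<gamma> \<tau> k"
    for k0 \<gamma> \<tau>
  proof -
    define S where "S = K2 \<Phi> x m a \<theta> \<union> K31 \<Phi> x m a \<theta>"
    have gap: "gap \<Phi> x m k = ereal (window_max f m k - f k)" for k
      unfolding gap_def ell by (simp add: f)
    have lim: "lim (\<lambda>k. ereal (f k)) = ereal L"
      using ereal_lim by (rule limI)
    note Ks = S_def K1_def K2_def K31_def gap lim f d_def
    \<comment> \<open>Both \<open>K2\<close> and \<open>K31\<close> lie in \<open>K1\<close>, whose
      defining inequality is this bound.\<close>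
    have S: "a / 2 * (d j)\<^sup>2 \<le> window_max f m (Suc j) - f (Suc j)" if "j \<in> S" for j
      using that by (auto simp: Ks)
    have not_S: "window_max f m (Suc j) - f (Suc j) < a / 2 * (d j)\<^sup>2 \<or>
      a / 2 * d j powr (1 / \<theta>) \<le> window_max f m (Suc j) - f (Suc j) \<and>
      L - f (Suc j) \<le> a / 4 * d j powr (1 / \<theta>)" if "j \<notin> S" for j
      using that by (auto simp: Ks)
    have "summable d \<and> (\<exists>\<gamma> \<rho>. 0 < \<gamma> \<and> 0 < \<rho> \<and> \<rho> < 1 \<and>
           (\<forall>\<^sub>F k in sequentially. (\<Sum>i. d (k + i)) \<le> rate \<theta> \<gamma> \<rho> k))"
      using tail unfolding S_def[symmetric] gap
      by (intro length_rate[OF \<theta> \<open>\<theta> < 1\<close> S not_S \<gamma>\<tau>, where ?k0.0 = k0]) auto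
    then obtain \<gamma>' \<rho> where sum: "summable d" and \<rho>: "0 < \<gamma>'" "0 < \<rho>" "\<rho> < 1"
        and le: "\<forall>\<^sub>F k in sequentially. (\<Sum>i. d (k + i)) \<le> rate \<theta> \<gamma>' \<rho> k"
      by blast
    have sum': "summable (\<lambda>j. norm (x (j + 1) - x j))"
      using sum unfolding d_def .
    obtain z where z: "x \<longlonglongrightarrow> z"
      using convergent_if_summable_steps[OF sum'] by blast
    have "\<forall>\<^sub>F k in sequentially. norm (x k - z) \<le> Delta x k \<and> Delta x k \<le> rate \<theta> \<gamma>' \<rho> k"
      using le by eventually_elim (use norm_limit_diff_le_Delta[OF sum' z] in \<open>simp add: Delta_def d_def\<close>)
    then show ?thesis
      using tendsto_imp_cluster_point[OF z] z sum' \<rho> by blast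
  qed

  show ?thesis
    unfolding f
  proof (intro conjI impI)
    show "\<exists>L::real. (\<lambda>k. ereal (f k)) \<longlonglongrightarrow> ereal L"
      using ereal_lim by blast
  qed (use finite in blast, elim conjE exE, rule rates, assumption+)
qed

end
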